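(* Let $\mathbb{K}$ be a field. Let $\Phi\colon ComMag \to preLie$ be the morphism of algebraic operads over $\mathbb{K}$ which sends the generating commutative operation $x\cdot y$ of $ComMag$ to the symmetrized pre-Lie product $x\# y := x*y+y*x$, where $*$ is the generating operation of $preLie$. Then $\Phi$ is injective.
   Context: All vector spaces and operads are over a field $\mathbb{K}$. An algebraic operad is a functor $\mathcal{O}$ from finite sets (with bijections) to vector spaces, with $\mathcal{O}(n)=\mathcal{O}[\{1,\dots,n\}]$ a module over the symmetric group $\mathbb{S}_n$, whose associated endofunctor $\mathcal{O}(V)=\bigoplus_{n\ge 1}\mathcal{O}(n)\otimes_{\mathbb{S}_n}V^{\otimes n}$ carries a monoid structure (associative composition $\gamma$ and unit $\iota$) given by transformations of functors. A type of algebras determines an operad via its free algebra functor; $\mathcal{O}(n)$ is the space of multilinear $n$-ary operations (the multilinear part of the free algebra on $n$ generators). A morphism of operads $\mathcal{O}\to\mathcal{O}'$ is injective if the linear maps $\mathcal{O}(n)\to\mathcal{O}'(n)$ are injective for all $n\ge 1$. A pre-Lie algebra is a vector space $L$ with a bilinear operation $*$ such that $(x*y)*z-x*(y*z)=(x*z)*y-x*(z*y)$ for all $x,y,z\in L$; $preLie$ is the operad encoding pre-Lie algebras. A $ComMag$-algebra is a vector space $A$ with a bilinear operation $\cdot$ satisfying only $x\cdot y=y\cdot x$ for all $x,y\in A$ (no associativity); $ComMag$ is the operad encoding these algebras. Any pre-Lie algebra is a $ComMag$-algebra under $x\# y=x*y+y*x$, and $\Phi$ is the induced morphism of operads.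
   Formalization: The field K is assumed to have characteristic 0; over a field of positive characteristic p the map Φ is not injective (a nonzero kernel element exists in arity p+1; for p = 2 it is the Jacobi identity of x#y). *)

theory Defs
  imports Complex_Main "HOL-Library.FuncSet" "HOL-Library.Disjoint_Sets"
begin

section \<open>Nonassociative algebras\<close>

locale nonassoc_algebra = vector_space scale
  for scale :: "'k::field \<Rightarrow> 'a::ab_group_add \<Rightarrow> 'a" +
  fixes mul :: "'a \<Rightarrow> 'a \<Rightarrow> 'a"
  assumes mul_add_left: "mul (x + y) z = mul x z + mul y z"
    and mul_add_right: "mul x (y + z) = mul x y + mul x z"
    and mul_scale_left: "mul (scale c x) y = scale c (mul x y)"
    and mul_scale_right: "mul x (scale c y) = scale c (mul x y)"

locale prelie_algebra = nonassoc_algebra +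
  assumes prelie: "mul (mul x y) z - mul x (mul y z) = mul (mul x z) y - mul x (mul z y)"

locale commag_algebra = nonassoc_algebra +
  assumes mul_commute: "mul x y = mul y x"

definition symmetrized :: "('a \<Rightarrow> 'a \<Rightarrow> 'a) \<Rightarrow> 'a \<Rightarrow> 'a \<Rightarrow> 'a::ab_group_add" where
  "symmetrized mul x y = mul x y + mul y x"

lemma (in nonassoc_algebra) commag_algebra_symmetrized:
  "commag_algebra scale (symmetrized mul)"
  by unfold_locales
    (simp_all add: symmetrized_def mul_add_left mul_add_right mul_scale_left mul_scale_right
      scale_right_distrib algebra_simps)

section \<open>Free algebras\<close>

text \<open>
  The free algebra of a given type is the algebra of formal expressions in the generators,
  modulo the smallest congruence that contains the vector space laws, the bilinearity of the
  product and the laws of the type (the parameter \<open>E\<close>).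
\<close>

datatype ('x, 'k) alg_term =
    TGen 'x
  | TZero
  | TAdd "('x, 'k) alg_term" "('x, 'k) alg_term"
  | TScale 'k "('x, 'k) alg_term"
  | TMul "('x, 'k) alg_term" "('x, 'k) alg_term"

abbreviation TSub :: "('x, 'k::field) alg_term \<Rightarrow> ('x, 'k) alg_term \<Rightarrow> ('x, 'k) alg_term" where
  "TSub s t \<equiv> TAdd s (TScale (- 1) t)"

inductive alg_eq ::
  "(('x, 'k::field) alg_term \<Rightarrow> ('x, 'k) alg_term \<Rightarrow> bool)
    \<Rightarrow> ('x, 'k) alg_term \<Rightarrow> ('x, 'k) alg_term \<Rightarrow> bool"
  for E where
  law: "E s t \<Longrightarrow> alg_eq E s t"
| refl: "alg_eq E s s"
| sym: "alg_eq E s t \<Longrightarrow> alg_eq E t s"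
| trans: "alg_eq E s t \<Longrightarrow> alg_eq E t u \<Longrightarrow> alg_eq E s u"
| add_cong: "alg_eq E s s' \<Longrightarrow> alg_eq E t t' \<Longrightarrow> alg_eq E (TAdd s t) (TAdd s' t')"
| scale_cong: "alg_eq E s s' \<Longrightarrow> alg_eq E (TScale c s) (TScale c s')"
| mul_cong: "alg_eq E s s' \<Longrightarrow> alg_eq E t t' \<Longrightarrow> alg_eq E (TMul s t) (TMul s' t')"
| add_assoc: "alg_eq E (TAdd (TAdd s t) u) (TAdd s (TAdd t u))"
| add_commute: "alg_eq E (TAdd s t) (TAdd t s)"
| add_zero: "alg_eq E (TAdd TZero s) s"
| add_neg: "alg_eq E (TAdd (TScale (- 1) s) s) TZero"
| scale_add: "alg_eq E (TScale c (TAdd s t)) (TAdd (TScale c s) (TScale c t))"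
| add_scale: "alg_eq E (TScale (c + d) s) (TAdd (TScale c s) (TScale d s))"
| scale_scale: "alg_eq E (TScale c (TScale d s)) (TScale (c * d) s)"
| scale_one: "alg_eq E (TScale 1 s) s"
| mul_add_left: "alg_eq E (TMul (TAdd s t) u) (TAdd (TMul s u) (TMul t u))"
| mul_add_right: "alg_eq E (TMul s (TAdd t u)) (TAdd (TMul s t) (TMul s u))"
| mul_scale_left: "alg_eq E (TMul (TScale c s) t) (TScale c (TMul s t))"
| mul_scale_right: "alg_eq E (TMul s (TScale c t)) (TScale c (TMul s t))"

lemma equivp_alg_eq: "equivp (alg_eq E)"
  by (intro equivpI reflpI sympI transpI) (auto intro: alg_eq.refl alg_eq.sym alg_eq.trans)

inductive prelie_law :: "('x, 'k::field) alg_term \<Rightarrow> ('x, 'k) alg_term \<Rightarrow> bool" where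
  "prelie_law (TSub (TMul (TMul s t) u) (TMul s (TMul t u)))
              (TSub (TMul (TMul s u) t) (TMul s (TMul u t)))"

inductive comm_law :: "('x, 'k::field) alg_term \<Rightarrow> ('x, 'k) alg_term \<Rightarrow> bool" where
  "comm_law (TMul s t) (TMul t s)"

quotient_type (overloaded) ('x, 'k) free_prelie =
  "('x, 'k::field) alg_term" / "alg_eq prelie_law"
  by (rule equivp_alg_eq)

quotient_type (overloaded) ('x, 'k) free_commag =
  "('x, 'k::field) alg_term" / "alg_eq comm_law"
  by (rule equivp_alg_eq)

instantiation free_prelie :: (type, field) ab_group_add
begin

lift_definition zero_free_prelie :: "('a, 'b) free_prelie" is TZero .
lift_definition plus_free_prelie ::
  "('a, 'b) free_prelie \<Rightarrow> ('a, 'b) free_prelie \<Rightarrow> ('a, 'b) free_prelie"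
  is TAdd by (rule alg_eq.add_cong)
lift_definition uminus_free_prelie :: "('a, 'b) free_prelie \<Rightarrow> ('a, 'b) free_prelie"
  is "TScale (- 1)" by (rule alg_eq.scale_cong)
lift_definition minus_free_prelie ::
  "('a, 'b) free_prelie \<Rightarrow> ('a, 'b) free_prelie \<Rightarrow> ('a, 'b) free_prelie"
  is TSub by (intro alg_eq.add_cong alg_eq.scale_cong)

instance
  by standard
    (transfer, (rule alg_eq.add_assoc alg_eq.add_commute alg_eq.add_zero alg_eq.add_neg
      alg_eq.refl))+

end

instantiation free_commag :: (type, field) ab_group_add
begin

lift_definition zero_free_commag :: "('a, 'b) free_commag" is TZero .
lift_definition plus_free_commag ::
  "('a, 'b) free_commag \<Rightarrow> ('a, 'b) free_commag \<Rightarrow> ('a, 'b) free_commag"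
  is TAdd by (rule alg_eq.add_cong)
lift_definition uminus_free_commag :: "('a, 'b) free_commag \<Rightarrow> ('a, 'b) free_commag"
  is "TScale (- 1)" by (rule alg_eq.scale_cong)
lift_definition minus_free_commag ::
  "('a, 'b) free_commag \<Rightarrow> ('a, 'b) free_commag \<Rightarrow> ('a, 'b) free_commag"
  is TSub by (intro alg_eq.add_cong alg_eq.scale_cong)

instance
  by standard
    (transfer, (rule alg_eq.add_assoc alg_eq.add_commute alg_eq.add_zero alg_eq.add_neg
      alg_eq.refl))+

end

lift_definition prelie_gen :: "'x \<Rightarrow> ('x, 'k::field) free_prelie" is TGen .
lift_definition prelie_scale :: "'k::field \<Rightarrow> ('x, 'k) free_prelie \<Rightarrow> ('x, 'k) free_prelie"
  is TScale by (rule alg_eq.scale_cong)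
lift_definition prelie_mul ::
  "('x, 'k::field) free_prelie \<Rightarrow> ('x, 'k) free_prelie \<Rightarrow> ('x, 'k) free_prelie"
  is TMul by (rule alg_eq.mul_cong)

lift_definition commag_gen :: "'x \<Rightarrow> ('x, 'k::field) free_commag" is TGen .
lift_definition commag_scale :: "'k::field \<Rightarrow> ('x, 'k) free_commag \<Rightarrow> ('x, 'k) free_commag"
  is TScale by (rule alg_eq.scale_cong)
lift_definition commag_mul ::
  "('x, 'k::field) free_commag \<Rightarrow> ('x, 'k) free_commag \<Rightarrow> ('x, 'k) free_commag"
  is TMul by (rule alg_eq.mul_cong)

interpretation free_prelie: prelie_algebra
  "prelie_scale :: 'k::field \<Rightarrow> ('x, 'k) free_prelie \<Rightarrow> _" prelie_mul
  apply unfold_locales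
  subgoal by transfer (rule alg_eq.scale_add)
  subgoal by transfer (rule alg_eq.add_scale)
  subgoal by transfer (rule alg_eq.scale_scale)
  subgoal by transfer (rule alg_eq.scale_one)
  subgoal by transfer (rule alg_eq.mul_add_left)
  subgoal by transfer (rule alg_eq.mul_add_right)
  subgoal by transfer (rule alg_eq.mul_scale_left)
  subgoal by transfer (rule alg_eq.mul_scale_right)
  subgoal by transfer (intro alg_eq.law prelie_law.intros)
  done

interpretation free_commag: commag_algebra
  "commag_scale :: 'k::field \<Rightarrow> ('x, 'k) free_commag \<Rightarrow> _" commag_mul
  apply unfold_locales
  subgoal by transfer (rule alg_eq.scale_add)
  subgoal by transfer (rule alg_eq.add_scale)
  subgoal by transfer (rule alg_eq.scale_scale)
  subgoal by transfer (rule alg_eq.scale_one)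
  subgoal by transfer (rule alg_eq.mul_add_left)
  subgoal by transfer (rule alg_eq.mul_add_right)
  subgoal by transfer (rule alg_eq.mul_scale_left)
  subgoal by transfer (rule alg_eq.mul_scale_right)
  subgoal by transfer (intro alg_eq.law comm_law.intros)
  done

primrec term_eval ::
  "('k \<Rightarrow> 'a \<Rightarrow> 'a) \<Rightarrow> ('a \<Rightarrow> 'a \<Rightarrow> 'a) \<Rightarrow> ('x \<Rightarrow> 'a) \<Rightarrow> ('x, 'k) alg_term \<Rightarrow> 'a::ab_group_add"
where
  "term_eval scale mul g (TGen x) = g x"
| "term_eval scale mul g TZero = 0"
| "term_eval scale mul g (TAdd s t) = term_eval scale mul g s + term_eval scale mul g t"
| "term_eval scale mul g (TScale c s) = scale c (term_eval scale mul g s)"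
| "term_eval scale mul g (TMul s t) = mul (term_eval scale mul g s) (term_eval scale mul g t)"

lemma (in nonassoc_algebra) term_eval_cong:
  assumes "alg_eq E s t"
    and "\<And>s t. E s t \<Longrightarrow> term_eval scale mul g s = term_eval scale mul g t"
  shows "term_eval scale mul g s = term_eval scale mul g t"
  using assms(1)
  by induction
    (auto simp: assms(2) mul_add_left mul_add_right mul_scale_left mul_scale_right
      scale_right_distrib scale_left_distrib add_ac)

text \<open>
  The homomorphism from a free algebra that is given by its values on the generators.  It
  does not depend on the chosen representative when the target is a pre-Lie algebra
  (resp. a commutative magmatic algebra).
\<close>

definition prelie_ext ::
  "('k::field \<Rightarrow> 'a \<Rightarrow> 'a) \<Rightarrow> ('a \<Rightarrow> 'a \<Rightarrow> 'a) \<Rightarrow> ('x \<Rightarrow> 'a) \<Rightarrow> ('x, 'k) free_prelie \<Rightarrow> 'a::ab_group_add"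
where
  "prelie_ext scale mul g a = term_eval scale mul g (rep_free_prelie a)"

definition commag_ext ::
  "('k::field \<Rightarrow> 'a \<Rightarrow> 'a) \<Rightarrow> ('a \<Rightarrow> 'a \<Rightarrow> 'a) \<Rightarrow> ('x \<Rightarrow> 'a) \<Rightarrow> ('x, 'k) free_commag \<Rightarrow> 'a::ab_group_add"
where
  "commag_ext scale mul g a = term_eval scale mul g (rep_free_commag a)"

context prelie_algebra
begin

lemma prelie_ext_abs: "prelie_ext scale mul g (abs_free_prelie s) = term_eval scale mul g s"
  unfolding prelie_ext_def
proof (rule term_eval_cong)
  show "alg_eq prelie_law (rep_free_prelie (abs_free_prelie s)) s"
    by (rule Quotient3_rep_abs[OF Quotient3_free_prelie]) (rule alg_eq.refl)
next
  show "term_eval scale mul g t = term_eval scale mul g u" if "prelie_law t u" for t u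
    using that by cases (simp add: prelie)
qed

lemma prelie_ext_gen: "prelie_ext scale mul g (prelie_gen x) = g x"
  by (simp add: prelie_gen.abs_eq prelie_ext_abs)

lemma prelie_ext_add:
  "prelie_ext scale mul g (a + b) = prelie_ext scale mul g a + prelie_ext scale mul g b"
  by (induction a; induction b) (simp add: plus_free_prelie.abs_eq prelie_ext_abs)

lemma prelie_ext_scale:
  "prelie_ext scale mul g (prelie_scale c a) = scale c (prelie_ext scale mul g a)"
  by (induction a) (simp add: prelie_scale.abs_eq prelie_ext_abs)

lemma prelie_ext_mul:
  "prelie_ext scale mul g (prelie_mul a b) = mul (prelie_ext scale mul g a) (prelie_ext scale mul g b)"
  by (induction a; induction b) (simp add: prelie_mul.abs_eq prelie_ext_abs)

lemma prelie_ext_unique: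
  assumes "\<And>x. h (prelie_gen x) = g x" "\<And>a b. h (a + b) = h a + h b"
    and "\<And>c a. h (prelie_scale c a) = scale c (h a)" "\<And>a b. h (prelie_mul a b) = mul (h a) (h b)"
  shows "h = prelie_ext scale mul g"
proof
  fix a
  have "h (abs_free_prelie s) = term_eval scale mul g s" for s
  proof (induction s)
    case TZero
    have "h 0 + h 0 = h 0 + 0" using assms(2)[of 0 0] by simp
    then show ?case by (simp add: zero_free_prelie_def)
  qed (simp_all add: assms flip: prelie_gen.abs_eq plus_free_prelie.abs_eq
      prelie_scale.abs_eq prelie_mul.abs_eq)
  then show "h a = prelie_ext scale mul g a"
    by (induction a) (simp add: prelie_ext_abs)
qed

end

context commag_algebra
begin

lemma commag_ext_abs: "commag_ext scale mul g (abs_free_commag s) = term_eval scale mul g s"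
  unfolding commag_ext_def
proof (rule term_eval_cong)
  show "alg_eq comm_law (rep_free_commag (abs_free_commag s)) s"
    by (rule Quotient3_rep_abs[OF Quotient3_free_commag]) (rule alg_eq.refl)
next
  show "term_eval scale mul g t = term_eval scale mul g u" if "comm_law t u" for t u
    using that by cases (simp add: mul_commute)
qed

lemma commag_ext_gen: "commag_ext scale mul g (commag_gen x) = g x"
  by (simp add: commag_gen.abs_eq commag_ext_abs)

lemma commag_ext_add:
  "commag_ext scale mul g (a + b) = commag_ext scale mul g a + commag_ext scale mul g b"
  by (induction a; induction b) (simp add: plus_free_commag.abs_eq commag_ext_abs)

lemma commag_ext_scale:
  "commag_ext scale mul g (commag_scale c a) = scale c (commag_ext scale mul g a)"
  by (induction a) (simp add: commag_scale.abs_eq commag_ext_abs)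

lemma commag_ext_mul:
  "commag_ext scale mul g (commag_mul a b) = mul (commag_ext scale mul g a) (commag_ext scale mul g b)"
  by (induction a; induction b) (simp add: commag_mul.abs_eq commag_ext_abs)

lemma commag_ext_unique:
  assumes "\<And>x. h (commag_gen x) = g x" "\<And>a b. h (a + b) = h a + h b"
    and "\<And>c a. h (commag_scale c a) = scale c (h a)" "\<And>a b. h (commag_mul a b) = mul (h a) (h b)"
  shows "h = commag_ext scale mul g"
proof
  fix a
  have "h (abs_free_commag s) = term_eval scale mul g s" for s
  proof (induction s)
    case TZero
    have "h 0 + h 0 = h 0 + 0" using assms(2)[of 0 0] by simp
    then show ?case by (simp add: zero_free_commag_def)
  qed (simp_all add: assms flip: commag_gen.abs_eq plus_free_commag.abs_eq
      commag_scale.abs_eq commag_mul.abs_eq)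
  then show "h a = commag_ext scale mul g a"
    by (induction a) (simp add: commag_ext_abs)
qed

end

section \<open>Operads\<close>

text \<open>
  An operad is given on the finite nonempty subsets \<open>I\<close> of a fixed type of labels, with
  \<open>\<O>(n) = \<O>[{1..n}]\<close> for labels in \<open>nat\<close>.  All components \<open>\<O>[I]\<close> are subspaces of one ambient
  vector space.  The monoid structure \<open>\<gamma> : \<O> \<circ> \<O> \<rightarrow> \<O>\<close> is
  given by its components \<open>\<O>[I] \<otimes> (\<Otimes>i\<in>I. \<O>[J i]) \<rightarrow> \<O>[\<Union>i\<in>I. J i]\<close> for pairwise
  disjoint \<open>J i\<close>, and \<open>\<iota>\<close> by the elements \<open>\<iota> x \<in> \<O>[{x}]\<close>.
\<close>

record ('x, 'k, 'a) operad_data =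
  op_space :: "'x set \<Rightarrow> 'a set"
  op_scale :: "'k \<Rightarrow> 'a \<Rightarrow> 'a"
  op_map :: "'x set \<Rightarrow> ('x \<Rightarrow> 'x) \<Rightarrow> 'a \<Rightarrow> 'a"
  op_comp :: "'x set \<Rightarrow> ('x \<Rightarrow> 'x set) \<Rightarrow> 'a \<Rightarrow> ('x \<Rightarrow> 'a) \<Rightarrow> 'a"
  op_unit :: "'x \<Rightarrow> 'a"

definition label_set :: "'x set \<Rightarrow> bool" where
  "label_set I \<longleftrightarrow> finite I \<and> I \<noteq> {}"

definition label_family :: "'x set \<Rightarrow> ('x \<Rightarrow> 'x set) \<Rightarrow> bool" where
  "label_family I J \<longleftrightarrow> label_set I \<and> (\<forall>i\<in>I. label_set (J i)) \<and> disjoint_family_on J I"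

definition linear_on ::
  "('k \<Rightarrow> 'a \<Rightarrow> 'a) \<Rightarrow> ('k \<Rightarrow> 'b \<Rightarrow> 'b) \<Rightarrow> 'a set \<Rightarrow> ('a::ab_group_add \<Rightarrow> 'b::ab_group_add) \<Rightarrow> bool"
where
  "linear_on scale1 scale2 S f \<longleftrightarrow>
    (\<forall>u\<in>S. \<forall>v\<in>S. f (u + v) = f u + f v) \<and> (\<forall>c. \<forall>u\<in>S. f (scale1 c u) = scale2 c (f u))"

text \<open>
  The congruence axioms say that relabelling and composition only depend on the values of
  their family arguments on the index set.
\<close>

locale operad = vector_space "op_scale P"
  for P :: "('x, 'k::field, 'a::ab_group_add) operad_data" +
  assumes space_subspace: "label_set I \<Longrightarrow> subspace (op_space P I)"
    and map_closed: "label_set I \<Longrightarrow> inj_on \<sigma> I \<Longrightarrow>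
      op_map P I \<sigma> \<in> op_space P I \<rightarrow> op_space P (\<sigma> ` I)"
    and map_linear: "label_set I \<Longrightarrow> inj_on \<sigma> I \<Longrightarrow>
      linear_on (op_scale P) (op_scale P) (op_space P I) (op_map P I \<sigma>)"
    and map_cong: "label_set I \<Longrightarrow> inj_on \<sigma> I \<Longrightarrow> (\<And>i. i \<in> I \<Longrightarrow> \<sigma> i = \<tau> i) \<Longrightarrow>
      f \<in> op_space P I \<Longrightarrow> op_map P I \<sigma> f = op_map P I \<tau> f"
    and map_id: "label_set I \<Longrightarrow> f \<in> op_space P I \<Longrightarrow> op_map P I id f = f"
    and map_comp: "label_set I \<Longrightarrow> inj_on \<sigma> I \<Longrightarrow> inj_on \<tau> (\<sigma> ` I) \<Longrightarrow> f \<in> op_space P I \<Longrightarrow>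
      op_map P (\<sigma> ` I) \<tau> (op_map P I \<sigma> f) = op_map P I (\<tau> \<circ> \<sigma>) f"
    and unit_closed: "op_unit P x \<in> op_space P {x}"
    and unit_natural: "op_map P {x} \<sigma> (op_unit P x) = op_unit P (\<sigma> x)"
    and comp_closed: "label_family I J \<Longrightarrow> f \<in> op_space P I \<Longrightarrow> g \<in> (\<Pi> i\<in>I. op_space P (J i)) \<Longrightarrow>
      op_comp P I J f g \<in> op_space P (\<Union>i\<in>I. J i)"
    and comp_cong: "label_family I J \<Longrightarrow> f \<in> op_space P I \<Longrightarrow> g \<in> (\<Pi> i\<in>I. op_space P (J i)) \<Longrightarrow>
      (\<And>i. i \<in> I \<Longrightarrow> J i = J' i) \<Longrightarrow> (\<And>i. i \<in> I \<Longrightarrow> g i = g' i) \<Longrightarrow>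
      op_comp P I J f g = op_comp P I J' f g'"
    and comp_linear_left: "label_family I J \<Longrightarrow> g \<in> (\<Pi> i\<in>I. op_space P (J i)) \<Longrightarrow>
      linear_on (op_scale P) (op_scale P) (op_space P I) (\<lambda>f. op_comp P I J f g)"
    and comp_linear_right: "label_family I J \<Longrightarrow> f \<in> op_space P I \<Longrightarrow>
      g \<in> (\<Pi> i\<in>I. op_space P (J i)) \<Longrightarrow> i \<in> I \<Longrightarrow>
      linear_on (op_scale P) (op_scale P) (op_space P (J i)) (\<lambda>u. op_comp P I J f (g(i := u)))"
    and comp_natural_outer: "label_set I \<Longrightarrow> inj_on \<sigma> I \<Longrightarrow> label_family (\<sigma> ` I) J \<Longrightarrow>
      f \<in> op_space P I \<Longrightarrow> g \<in> (\<Pi> i\<in>\<sigma> ` I. op_space P (J i)) \<Longrightarrow>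
      op_comp P (\<sigma> ` I) J (op_map P I \<sigma> f) g = op_comp P I (J \<circ> \<sigma>) f (g \<circ> \<sigma>)"
    and comp_natural_inner: "label_family I J \<Longrightarrow> inj_on \<tau> (\<Union>i\<in>I. J i) \<Longrightarrow>
      f \<in> op_space P I \<Longrightarrow> g \<in> (\<Pi> i\<in>I. op_space P (J i)) \<Longrightarrow>
      op_map P (\<Union>i\<in>I. J i) \<tau> (op_comp P I J f g) =
      op_comp P I (\<lambda>i. \<tau> ` J i) f (\<lambda>i. op_map P (J i) \<tau> (g i))"
    and comp_unit_left: "label_set (J x) \<Longrightarrow> g x \<in> op_space P (J x) \<Longrightarrow>
      op_comp P {x} J (op_unit P x) g = g x"
    and comp_unit_right: "label_set I \<Longrightarrow> f \<in> op_space P I \<Longrightarrow>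
      op_comp P I (\<lambda>i. {i}) f (op_unit P) = f"
    and comp_assoc: "label_family I J \<Longrightarrow> label_family (\<Union>i\<in>I. J i) K \<Longrightarrow> f \<in> op_space P I \<Longrightarrow>
      g \<in> (\<Pi> i\<in>I. op_space P (J i)) \<Longrightarrow> h \<in> (\<Pi> j\<in>(\<Union>i\<in>I. J i). op_space P (K j)) \<Longrightarrow>
      op_comp P (\<Union>i\<in>I. J i) K (op_comp P I J f g) h =
      op_comp P I (\<lambda>i. \<Union>j\<in>J i. K j) f (\<lambda>i. op_comp P (J i) K (g i) h)"

locale operad_morphism = P: operad P + Q: operad Q
  for P :: "('x, 'k::field, 'a::ab_group_add) operad_data"
    and Q :: "('x, 'k, 'b::ab_group_add) operad_data" +
  fixes \<Phi> :: "'x set \<Rightarrow> 'a \<Rightarrow> 'b"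
  assumes closed: "label_set I \<Longrightarrow> \<Phi> I \<in> op_space P I \<rightarrow> op_space Q I"
    and linear: "label_set I \<Longrightarrow> linear_on (op_scale P) (op_scale Q) (op_space P I) (\<Phi> I)"
    and natural: "label_set I \<Longrightarrow> inj_on \<sigma> I \<Longrightarrow> f \<in> op_space P I \<Longrightarrow>
      \<Phi> (\<sigma> ` I) (op_map P I \<sigma> f) = op_map Q I \<sigma> (\<Phi> I f)"
    and unit: "\<Phi> {x} (op_unit P x) = op_unit Q x"
    and comp: "label_family I J \<Longrightarrow> f \<in> op_space P I \<Longrightarrow> g \<in> (\<Pi> i\<in>I. op_space P (J i)) \<Longrightarrow>
      \<Phi> (\<Union>i\<in>I. J i) (op_comp P I J f g) = op_comp Q I J (\<Phi> I f) (\<lambda>i. \<Phi> (J i) (g i))"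

abbreviation arity_space :: "(nat, 'k, 'a) operad_data \<Rightarrow> nat \<Rightarrow> 'a set" where
  "arity_space P n \<equiv> op_space P {1..n}"

definition injective_morphism ::
  "(nat, 'k, 'a) operad_data \<Rightarrow> (nat set \<Rightarrow> 'a \<Rightarrow> 'b) \<Rightarrow> bool" where
  "injective_morphism P \<Phi> \<longleftrightarrow> (\<forall>n\<ge>1. inj_on (\<Phi> {1..n}) (arity_space P n))"

section \<open>The operad of a type of algebras\<close>

text \<open>
  The monomials in which every generator of \<open>I\<close> occurs exactly once, and no other generator
  occurs.  Their span is the multilinear part of the free algebra on the set \<open>I\<close>, seen inside
  the free algebra on all labels.
\<close>

inductive multilinear_monomial ::
  "('x \<Rightarrow> 'a) \<Rightarrow> ('a \<Rightarrow> 'a \<Rightarrow> 'a) \<Rightarrow> 'x set \<Rightarrow> 'a \<Rightarrow> bool"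
  for gen mul where
  gen: "multilinear_monomial gen mul {x} (gen x)"
| mul: "multilinear_monomial gen mul I a \<Longrightarrow> multilinear_monomial gen mul J b \<Longrightarrow> I \<inter> J = {} \<Longrightarrow>
    multilinear_monomial gen mul (I \<union> J) (mul a b)"

definition multilinear_part ::
  "('k::field \<Rightarrow> 'a::ab_group_add \<Rightarrow> 'a) \<Rightarrow> ('x \<Rightarrow> 'a) \<Rightarrow> ('a \<Rightarrow> 'a \<Rightarrow> 'a) \<Rightarrow> 'x set \<Rightarrow> 'a set"
where
  "multilinear_part scale gen mul I = module.span scale {a. multilinear_monomial gen mul I a}"

text \<open>Composition is substitution: \<open>subst g\<close> is the endomorphism with \<open>gen x \<mapsto> g x\<close>.\<close>

definition operad_of_free_algebra ::
  "('k::field \<Rightarrow> 'a::ab_group_add \<Rightarrow> 'a) \<Rightarrow> ('x \<Rightarrow> 'a) \<Rightarrow> ('a \<Rightarrow> 'a \<Rightarrow> 'a)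
    \<Rightarrow> (('x \<Rightarrow> 'a) \<Rightarrow> 'a \<Rightarrow> 'a) \<Rightarrow> ('x, 'k, 'a) operad_data"
where
  "operad_of_free_algebra scale gen mul subst =
    \<lparr> op_space = multilinear_part scale gen mul,
      op_scale = scale,
      op_map = (\<lambda>I \<sigma>. subst (gen \<circ> \<sigma>)),
      op_comp = (\<lambda>I J f g. subst g f),
      op_unit = gen \<rparr>"

definition preLie :: "('x, 'k::field, ('x, 'k) free_prelie) operad_data" where
  "preLie = operad_of_free_algebra prelie_scale prelie_gen prelie_mul
    (prelie_ext prelie_scale prelie_mul)"

definition ComMag :: "('x, 'k::field, ('x, 'k) free_commag) operad_data" where
  "ComMag = operad_of_free_algebra commag_scale commag_gen commag_mul
    (commag_ext commag_scale commag_mul)"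

subsection \<open>They are operads\<close>

locale substitution_algebra = nonassoc_algebra scale mul
  for scale :: "'k::field \<Rightarrow> 'a::ab_group_add \<Rightarrow> 'a" and mul +
  fixes gen :: "'x \<Rightarrow> 'a" and subst :: "('x \<Rightarrow> 'a) \<Rightarrow> 'a \<Rightarrow> 'a"
  assumes subst_gen: "subst g (gen x) = g x"
    and subst_add: "subst g (a + b) = subst g a + subst g b"
    and subst_scale: "subst g (scale c a) = scale c (subst g a)"
    and subst_mul: "subst g (mul a b) = mul (subst g a) (subst g b)"
begin

abbreviation "mlin \<equiv> multilinear_part scale gen mul"
abbreviation "monom \<equiv> multilinear_monomial gen mul"

lemma mlin_subspace: "subspace (mlin I)"
  by (simp add: multilinear_part_def)

lemma monom_mlin: "monom I a \<Longrightarrow> a \<in> mlin I"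
  by (simp add: multilinear_part_def span_base)

lemma mlin_zero: "0 \<in> mlin I"
  and mlin_add: "a \<in> mlin I \<Longrightarrow> b \<in> mlin I \<Longrightarrow> a + b \<in> mlin I"
  and mlin_scale: "a \<in> mlin I \<Longrightarrow> scale c a \<in> mlin I"
  using mlin_subspace[of I] by (auto simp: subspace_def)

lemma mlin_induct [consumes 1, case_names zero add monom]:
  assumes "a \<in> mlin I" and "P 0"
    and "\<And>c a b. a \<in> mlin I \<Longrightarrow> b \<in> mlin I \<Longrightarrow> P a \<Longrightarrow> P b \<Longrightarrow> P (scale c a + b)"
    and "\<And>a. monom I a \<Longrightarrow> P a"
  shows "P a"
proof -
  have "a \<in> mlin I \<and> P a"
    using assms(1) unfolding multilinear_part_def
  proof (induction rule: span_induct_alt)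
    case base
    then show ?case by (simp add: assms(2) span_zero)
  next
    case (step c x y)
    then have "monom I x" by simp
    then show ?case using step assms(3)[of x y c] assms(4)[of x]
      by (auto simp: multilinear_part_def intro: span_add span_scale span_base)
  qed
  then show ?thesis ..
qed

lemma mul_zero_left: "mul 0 b = 0" and mul_zero_right: "mul b 0 = 0"
  using mul_scale_left[of 0 0 b] mul_scale_right[of b 0 0] by simp_all

lemma subst_zero: "subst g 0 = 0"
  using subst_scale[of g 0 0] by simp

lemma mlin_mul:
  assumes "a \<in> mlin I" "b \<in> mlin J" "I \<inter> J = {}"
  shows "mul a b \<in> mlin (I \<union> J)"
  using assms(1)
proof (induction rule: mlin_induct)
  case (monom a)
  note a = this
  show ?case using assms(2)
  proof (induction rule: mlin_induct)
    case (monom b)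
    then show ?case using a assms(3) by (intro monom_mlin multilinear_monomial.mul)
  qed (simp_all add: mul_zero_right mul_add_right mul_scale_right mlin_zero mlin_add mlin_scale)
qed (simp_all add: mul_zero_left mul_add_left mul_scale_left mlin_zero mlin_add mlin_scale)

lemma subst_closed_monom:
  assumes "monom I a" "disjoint_family_on J I" "\<And>i. i \<in> I \<Longrightarrow> g i \<in> mlin (J i)"
  shows "subst g a \<in> mlin (\<Union>i\<in>I. J i)"
  using assms
proof (induction rule: multilinear_monomial.induct)
  case (gen x)
  show ?case using gen(2)[of x] by (simp add: subst_gen)
next
  case (mul I a I' b)
  have "J i \<inter> J i' = {}" if "i \<in> I" "i' \<in> I'" for i i'
    using that mul.hyps(3) by (intro disjoint_family_onD[OF mul.prems(1)]) auto
  then have "(\<Union>i\<in>I. J i) \<inter> (\<Union>i\<in>I'. J i) = {}" by auto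
  moreover have "disjoint_family_on J I" "disjoint_family_on J I'"
    using mul.prems(1) by (auto simp: disjoint_family_on_def)
  ultimately have "mul (subst g a) (subst g b) \<in> mlin ((\<Union>i\<in>I. J i) \<union> (\<Union>i\<in>I'. J i))"
    using mul.prems(2) by (intro mlin_mul mul.IH) auto
  then show ?case by (simp only: subst_mul UN_Un)
qed

lemma subst_closed:
  assumes "a \<in> mlin I" "disjoint_family_on J I" "\<And>i. i \<in> I \<Longrightarrow> g i \<in> mlin (J i)"
  shows "subst g a \<in> mlin (\<Union>i\<in>I. J i)"
  using assms(1)
proof (induction rule: mlin_induct)
  case (monom a)
  then show ?case using assms(2,3) by (rule subst_closed_monom)
qed (simp_all add: subst_zero subst_add subst_scale mlin_zero mlin_add mlin_scale)

lemma subst_cong_monom: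
  assumes "monom I a" "\<And>i. i \<in> I \<Longrightarrow> g i = g' i"
  shows "subst g a = subst g' a"
  using assms by (induction rule: multilinear_monomial.induct) (simp_all add: subst_gen subst_mul)

lemma subst_cong:
  assumes "a \<in> mlin I" "\<And>i. i \<in> I \<Longrightarrow> g i = g' i"
  shows "subst g a = subst g' a"
  using assms(1)
  by (induction rule: mlin_induct)
    (simp_all add: subst_zero subst_add subst_scale subst_cong_monom[OF _ assms(2)])

lemma subst_subst_monom:
  assumes "monom I a"
  shows "subst h (subst g a) = subst (\<lambda>i. subst h (g i)) a"
  using assms by (induction rule: multilinear_monomial.induct) (simp_all add: subst_gen subst_mul)

lemma subst_subst:
  assumes "a \<in> mlin I"
  shows "subst h (subst g a) = subst (\<lambda>i. subst h (g i)) a"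
  using assms
  by (induction rule: mlin_induct)
    (simp_all add: subst_zero subst_add subst_scale subst_subst_monom)

lemma subst_id_monom:
  assumes "monom I a"
  shows "subst gen a = a"
  using assms by (induction rule: multilinear_monomial.induct) (simp_all add: subst_gen subst_mul)

lemma subst_id:
  assumes "a \<in> mlin I"
  shows "subst gen a = a"
  using assms
  by (induction rule: mlin_induct) (simp_all add: subst_zero subst_add subst_scale subst_id_monom)

lemma subst_linear_monom:
  assumes "monom I a" "i \<in> I"
  shows "subst (g(i := u + v)) a = subst (g(i := u)) a + subst (g(i := v)) a
    \<and> subst (g(i := scale c u)) a = scale c (subst (g(i := u)) a)"
  using assms
proof (induction rule: multilinear_monomial.induct)
  case (gen x)
  then show ?case by (simp add: subst_gen)
next
  case (mul I a I' b)
  show ?case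
  proof (cases "i \<in> I")
    case True
    then have "i \<notin> I'" using mul.hyps(3) by blast
    then have b: "subst (g(i := w)) b = subst g b" for w
      using mul.hyps(2) by (intro subst_cong_monom) auto
    then show ?thesis using mul.IH(1)[OF True]
      by (simp only: subst_mul b mul_add_left mul_scale_left simp_thms)
  next
    case False
    then have "i \<in> I'" using mul.prems by blast
    have a: "subst (g(i := w)) a = subst g a" for w
      using mul.hyps(1) False by (intro subst_cong_monom) auto
    then show ?thesis using mul.IH(2)[OF \<open>i \<in> I'\<close>]
      by (simp only: subst_mul a mul_add_right mul_scale_right simp_thms)
  qed
qed

lemma subst_linear:
  assumes "a \<in> mlin I" "i \<in> I"
  shows "subst (g(i := u + v)) a = subst (g(i := u)) a + subst (g(i := v)) a
    \<and> subst (g(i := scale c u)) a = scale c (subst (g(i := u)) a)"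
  using assms(1)
proof (induction rule: mlin_induct)
  case (monom a)
  then show ?case using subst_linear_monom assms(2) by blast
qed (simp_all add: subst_zero subst_add subst_scale scale_right_distrib algebra_simps)

lemma gen_mlin: "gen x \<in> mlin {x}"
  by (intro monom_mlin multilinear_monomial.gen)

lemma subst_relabel_closed:
  assumes "a \<in> mlin I" "inj_on \<sigma> I"
  shows "subst (gen \<circ> \<sigma>) a \<in> mlin (\<sigma> ` I)"
proof -
  have "subst (gen \<circ> \<sigma>) a \<in> mlin (\<Union>i\<in>I. {\<sigma> i})"
    using assms(2) by (intro subst_closed[OF assms(1)])
      (auto simp: disjoint_family_on_def inj_on_def gen_mlin)
  then show ?thesis by (simp add: UNION_singleton_eq_range)
qed

lemma operad_of_free_algebra: "operad (operad_of_free_algebra scale gen mul subst)"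
proof (unfold_locales, simp_all only: operad_of_free_algebra_def operad_data.simps)
  fix I J :: "'x set" and K L :: "'x \<Rightarrow> 'x set" and \<sigma> \<tau> :: "'x \<Rightarrow> 'x" and f :: 'a
    and g h :: "'x \<Rightarrow> 'a" and x i :: 'x
  show "subspace (mlin I)" by (rule mlin_subspace)
  show "gen x \<in> mlin {x}" by (rule gen_mlin)
  show "subst (gen \<circ> \<sigma>) (gen x) = gen (\<sigma> x)" by (simp add: subst_gen)
  show "subst g (gen x) = g x" by (rule subst_gen)
  show "subst (gen \<circ> \<sigma>) \<in> mlin I \<rightarrow> mlin (\<sigma> ` I)" if "inj_on \<sigma> I"
    using that subst_relabel_closed by blast
  show "linear_on scale scale (mlin I) (subst g)"
    by (simp add: linear_on_def subst_add subst_scale)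
  show "subst (gen \<circ> id) f = f" if "f \<in> mlin I"
    using that by (simp add: subst_id)
  show "subst (gen \<circ> \<sigma>) f = subst (gen \<circ> \<tau>) f"
    if "f \<in> mlin I" "\<And>i. i \<in> I \<Longrightarrow> \<sigma> i = \<tau> i"
    using that by (intro subst_cong[of f I]) auto
  show "subst (gen \<circ> \<tau>) (subst (gen \<circ> \<sigma>) f) = subst (gen \<circ> (\<tau> \<circ> \<sigma>)) f" if "f \<in> mlin I"
    using that by (simp add: subst_subst subst_gen comp_def)
  show "subst g f \<in> mlin (\<Union>i\<in>I. K i)"
    if "label_family I K" "f \<in> mlin I" "g \<in> (\<Pi> i\<in>I. mlin (K i))"
    using that by (intro subst_closed) (auto simp: label_family_def)
  show "subst g f = subst h f" if "f \<in> mlin I" "\<And>i. i \<in> I \<Longrightarrow> g i = h i"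
    using that by (rule subst_cong)
  show "linear_on scale scale (mlin (K i)) (\<lambda>u. subst (g(i := u)) f)" if "f \<in> mlin I" "i \<in> I"
    using subst_linear[OF that] by (simp add: linear_on_def)
  show "subst g (subst (gen \<circ> \<sigma>) f) = subst (g \<circ> \<sigma>) f" if "f \<in> mlin I"
    using that by (simp add: subst_subst subst_gen comp_def)
  show "subst (gen \<circ> \<tau>) (subst g f) = subst (\<lambda>i. subst (gen \<circ> \<tau>) (g i)) f" if "f \<in> mlin I"
    using that by (rule subst_subst)
  show "subst gen f = f" if "f \<in> mlin I"
    using that by (rule subst_id)
  show "subst h (subst g f) = subst (\<lambda>i. subst h (g i)) f" if "f \<in> mlin I"
    using that by (rule subst_subst)
qed (simp_all add: scale_right_distrib scale_left_distrib linear_on_def subst_add subst_scale)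

end

interpretation free_prelie: substitution_algebra
  "prelie_scale :: 'k::field \<Rightarrow> ('x, 'k) free_prelie \<Rightarrow> _" prelie_mul prelie_gen
  "prelie_ext prelie_scale prelie_mul"
  by unfold_locales
    (simp_all add: free_prelie.prelie_ext_gen free_prelie.prelie_ext_add
      free_prelie.prelie_ext_scale free_prelie.prelie_ext_mul)

interpretation free_commag: substitution_algebra
  "commag_scale :: 'k::field \<Rightarrow> ('x, 'k) free_commag \<Rightarrow> _" commag_mul commag_gen
  "commag_ext commag_scale commag_mul"
  by unfold_locales
    (simp_all add: free_commag.commag_ext_gen free_commag.commag_ext_add
      free_commag.commag_ext_scale free_commag.commag_ext_mul)

lemma operad_preLie: "operad preLie"
  unfolding preLie_def by (rule free_prelie.operad_of_free_algebra)

lemma operad_ComMag: "operad ComMag"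
  unfolding ComMag_def by (rule free_commag.operad_of_free_algebra)

subsection \<open>The morphism induced by the symmetrized product\<close>

interpretation symmetrized_prelie: commag_algebra
  "prelie_scale :: 'k::field \<Rightarrow> ('x, 'k) free_prelie \<Rightarrow> _" "symmetrized prelie_mul"
  by (rule free_prelie.commag_algebra_symmetrized)

definition symmetrization :: "('x, 'k::field) free_commag \<Rightarrow> ('x, 'k) free_prelie" where
  "symmetrization = commag_ext prelie_scale (symmetrized prelie_mul) prelie_gen"

lemma symmetrization_gen: "symmetrization (commag_gen x) = prelie_gen x"
  and symmetrization_add: "symmetrization (a + b) = symmetrization a + symmetrization b"
  and symmetrization_scale: "symmetrization (commag_scale c a) = prelie_scale c (symmetrization a)"
  and symmetrization_mul: "symmetrization (commag_mul a b) =
    symmetrized prelie_mul (symmetrization a) (symmetrization b)"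
  by (simp_all add: symmetrization_def symmetrized_prelie.commag_ext_gen
    symmetrized_prelie.commag_ext_add symmetrized_prelie.commag_ext_scale
    symmetrized_prelie.commag_ext_mul)

lemma symmetrization_zero: "symmetrization 0 = 0"
  using symmetrization_add[of 0 0] by simp

lemma symmetrization_closed_monom:
  assumes "free_commag.monom I a"
  shows "symmetrization a \<in> free_prelie.mlin I"
  using assms
proof (induction rule: multilinear_monomial.induct)
  case (gen x)
  then show ?case by (simp add: symmetrization_gen free_prelie.gen_mlin)
next
  case (mul I a J b)
  then show ?case
    using free_prelie.mlin_mul[OF mul.IH] free_prelie.mlin_mul[OF mul.IH(2,1)]
    by (auto simp: symmetrization_mul symmetrized_def Un_commute Int_commute
      intro: free_prelie.mlin_add)
qed

lemma symmetrization_closed: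
  assumes "a \<in> free_commag.mlin I"
  shows "symmetrization a \<in> free_prelie.mlin I"
  using assms
  by (induction rule: free_commag.mlin_induct)
    (simp_all add: symmetrization_zero symmetrization_add symmetrization_scale
      free_prelie.mlin_zero free_prelie.mlin_add free_prelie.mlin_scale symmetrization_closed_monom)

lemma symmetrization_subst_monom:
  fixes g :: "'x \<Rightarrow> ('x, 'k::field) free_commag"
  assumes "free_commag.monom I a"
  shows "symmetrization (commag_ext commag_scale commag_mul g a) =
    prelie_ext prelie_scale prelie_mul (\<lambda>i. symmetrization (g i)) (symmetrization a)"
  using assms
  by (induction rule: multilinear_monomial.induct)
    (simp_all add: symmetrization_gen symmetrization_mul symmetrized_def
      free_commag.subst_gen free_commag.subst_mul free_prelie.subst_gen free_prelie.subst_add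
      free_prelie.subst_mul)

lemma symmetrization_subst:
  fixes g :: "'x \<Rightarrow> ('x, 'k::field) free_commag"
  assumes "a \<in> free_commag.mlin I"
  shows "symmetrization (commag_ext commag_scale commag_mul g a) =
    prelie_ext prelie_scale prelie_mul (\<lambda>i. symmetrization (g i)) (symmetrization a)"
  using assms
  by (induction rule: free_commag.mlin_induct)
    (simp_all add: symmetrization_zero symmetrization_add symmetrization_scale
      free_commag.subst_zero free_commag.subst_add free_commag.subst_scale
      free_prelie.subst_zero free_prelie.subst_add free_prelie.subst_scale
      symmetrization_subst_monom)

lemma operad_simps:
  "op_space preLie = multilinear_part prelie_scale prelie_gen prelie_mul"
  "op_scale preLie = prelie_scale"
  "op_map preLie I \<sigma> = prelie_ext prelie_scale prelie_mul (prelie_gen \<circ> \<sigma>)"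
  "op_comp preLie I J f g = prelie_ext prelie_scale prelie_mul g f"
  "op_unit preLie = prelie_gen"
  "op_space ComMag = multilinear_part commag_scale commag_gen commag_mul"
  "op_scale ComMag = commag_scale"
  "op_map ComMag I' \<sigma>' = commag_ext commag_scale commag_mul (commag_gen \<circ> \<sigma>')"
  "op_comp ComMag I' J' f' g' = commag_ext commag_scale commag_mul g' f'"
  "op_unit ComMag = commag_gen"
  by (simp_all add: preLie_def ComMag_def operad_of_free_algebra_def)

theorem operad_morphism_symmetrization:
  "operad_morphism ComMag preLie
    (\<lambda>I. symmetrization :: ('x, 'k::field) free_commag \<Rightarrow> ('x, 'k) free_prelie)"
proof (intro operad_morphism.intro operad_ComMag operad_preLie operad_morphism_axioms.intro,
    simp_all only: operad_simps)
  fix I :: "'x set" and \<sigma> :: "'x \<Rightarrow> 'x" and x :: 'x and g :: "'x \<Rightarrow> ('x, 'k) free_commag"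
    and f :: "('x, 'k) free_commag"
  show "symmetrization \<in> free_commag.mlin I \<rightarrow> free_prelie.mlin I"
    using symmetrization_closed by blast
  show "linear_on commag_scale prelie_scale (free_commag.mlin I) symmetrization"
    by (simp add: linear_on_def symmetrization_add symmetrization_scale)
  show "symmetrization (commag_gen x) = prelie_gen x"
    by (rule symmetrization_gen)
  assume "f \<in> free_commag.mlin I"
  note subst = symmetrization_subst[OF this]
  show "symmetrization (commag_ext commag_scale commag_mul (commag_gen \<circ> \<sigma>) f) =
      prelie_ext prelie_scale prelie_mul (prelie_gen \<circ> \<sigma>) (symmetrization f)"
    by (simp add: subst symmetrization_gen comp_def)
  show "symmetrization (commag_ext commag_scale commag_mul g f) =
      prelie_ext prelie_scale prelie_mul (\<lambda>i. symmetrization (g i)) (symmetrization f)"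
    by (rule subst)
qed

lemma label_set_monom: "multilinear_monomial gen mul I a \<Longrightarrow> label_set I"
  by (induction rule: multilinear_monomial.induct) (auto simp: label_set_def)

theorem operad_morphism_unique:
  fixes \<Phi> :: "nat set \<Rightarrow> (nat, 'k::field) free_commag \<Rightarrow> (nat, 'k) free_prelie"
  assumes "operad_morphism ComMag preLie \<Phi>"
    and gen_op: "\<Phi> {1..2} (commag_mul (commag_gen 1) (commag_gen 2)) =
      symmetrized prelie_mul (prelie_gen 1) (prelie_gen 2)"
    and "label_set I" and "a \<in> op_space ComMag I"
  shows "\<Phi> I a = symmetrization a"
proof -
  interpret operad_morphism ComMag preLie \<Phi> by fact
  have two: "{1..2} = {1, 2::nat}" by auto
  have linear: "\<Phi> I (a + b) = \<Phi> I a + \<Phi> I b" "\<Phi> I (commag_scale c a) = prelie_scale c (\<Phi> I a)"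
    if "label_set I" "a \<in> free_commag.mlin I" "b \<in> free_commag.mlin I" for I a b c
    using linear[OF that(1)] that(2,3) by (simp_all add: linear_on_def operad_simps)
  have monom: "\<Phi> I a = symmetrization a" if "free_commag.monom I a" for I a
    using that
  proof (induction rule: multilinear_monomial.induct)
    case (gen x)
    then show ?case using unit[of x] by (simp add: operad_simps symmetrization_gen)
  next
    case (mul I a J b)
    define K where "K = (\<lambda>i::nat. if i = 1 then I else J)"
    define g where "g = (\<lambda>i::nat. if i = 1 then a else b)"
    have K: "label_family {1..2} K"
      using mul.hyps label_set_monom[OF mul.hyps(1)] label_set_monom[OF mul.hyps(2)]
      unfolding two by (auto simp: label_family_def K_def disjoint_family_on_def label_set_def)
    have f: "commag_mul (commag_gen 1) (commag_gen 2) \<in> op_space ComMag {1..2::nat}"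
      using free_commag.mlin_mul[OF free_commag.gen_mlin[of "1::nat"] free_commag.gen_mlin[of 2]]
      unfolding two by (simp add: operad_simps insert_commute)
    have g: "g \<in> (\<Pi> i\<in>{1..2}. op_space ComMag (K i))"
      using mul.hyps unfolding two by (auto simp: g_def K_def operad_simps free_commag.monom_mlin)
    have "(\<Union>i\<in>{1..2}. K i) = I \<union> J" unfolding two by (auto simp: K_def)
    then show ?case
      using comp[OF K f g] mul.IH gen_op
      by (simp add: operad_simps free_commag.subst_mul free_commag.subst_gen g_def K_def
        symmetrized_def free_prelie.subst_add free_prelie.subst_mul free_prelie.subst_gen
        symmetrization_mul)
  qed
  have "a \<in> free_commag.mlin I" using assms(4) by (simp add: operad_simps)
  then show ?thesis
  proof (induction rule: free_commag.mlin_induct)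
    case zero
    show ?case using linear(1)[OF assms(3) free_commag.mlin_zero free_commag.mlin_zero]
      by (simp add: symmetrization_zero)
  next
    case (add c a b)
    then show ?case
      by (simp add: linear assms(3) free_commag.mlin_scale symmetrization_add symmetrization_scale)
  qed (rule monom)
qed

text \<open>
  Injectivity fails over fields of small positive characteristic.  In characteristic 2 the
  symmetrized product is the commutator, so it satisfies the Jacobi identity.
\<close>

theorem not_injective_char_2:
  assumes "(2::'k::field) = 0"
  shows "\<not> injective_morphism ComMag
    (\<lambda>I. symmetrization :: (nat, 'k) free_commag \<Rightarrow> (nat, 'k) free_prelie)"
proof
  assume inj: "injective_morphism ComMag
    (\<lambda>I. symmetrization :: (nat, 'k) free_commag \<Rightarrow> (nat, 'k) free_prelie)"
  let ?x = "\<lambda>i::nat. commag_gen i :: (nat, 'k) free_commag"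
  let ?y = "\<lambda>i::nat. prelie_gen i :: (nat, 'k) free_prelie"
  let ?l = "\<lambda>i j k. prelie_mul (prelie_mul (?y i) (?y j)) (?y k)"
  let ?r = "\<lambda>i j k. prelie_mul (?y i) (prelie_mul (?y j) (?y k))"
  let ?m = "\<lambda>i j k. commag_mul (commag_mul (?x i) (?x j)) (?x k)"
  let ?j = "?m 1 2 3 + ?m 2 3 1 + ?m 3 1 2"
  have three: "{1..3} = {1, 2, 3::nat}" by auto
  have m: "?m i j k \<in> op_space ComMag {1..3}" if "distinct [i, j, k]" "{i, j, k} = {1..3}" for i j k
  proof -
    have "commag_mul (?x i) (?x j) \<in> free_commag.mlin ({i} \<union> {j})"
      using that(1) by (intro free_commag.mlin_mul free_commag.gen_mlin) auto
    then have "?m i j k \<in> free_commag.mlin (({i} \<union> {j}) \<union> {k})"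
      using that(1) by (intro free_commag.mlin_mul free_commag.gen_mlin) auto
    also have "({i} \<union> {j}) \<union> {k} = {1..3}" using that(2) by auto
    finally show ?thesis by (simp add: operad_simps)
  qed
  have j: "?j \<in> op_space ComMag {1..3}"
    using m[of 1 2 3] m[of 2 3 1] m[of 3 1 2] unfolding three
    by (auto simp: operad_simps intro!: free_commag.mlin_add)
  have double: "a + a = 0" for a :: "(nat, 'k) free_prelie"
  proof -
    have "a + a = prelie_scale (1 + 1) a"
      by (simp only: free_prelie.scale_left_distrib free_prelie.scale_one)
    also have "(1 + 1 :: 'k) = 0" using assms by simp
    finally show ?thesis by simp
  qed
  then have "- b = b" for b :: "(nat, 'k) free_prelie"
    by (rule minus_unique)
  then have minus: "a - b = a + b" for a b :: "(nat, 'k) free_prelie"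
    by (simp only: diff_conv_add_uminus)
  have pl: "?l i j k + ?r i j k + (?l i k j + ?r i k j) = 0" for i j k
  proof -
    have "?l i j k + ?r i j k = ?l i k j + ?r i k j"
      using free_prelie.prelie[of "?y i" "?y j" "?y k"] by (simp only: minus)
    then show ?thesis by (simp only: double)
  qed
  have "symmetrization ?j = 0"
  proof -
    have "symmetrization ?j = (?l 1 2 3 + ?r 1 2 3 + (?l 1 3 2 + ?r 1 3 2))
      + (?l 2 3 1 + ?r 2 3 1 + (?l 2 1 3 + ?r 2 1 3)) + (?l 3 1 2 + ?r 3 1 2 + (?l 3 2 1 + ?r 3 2 1))"
      by (simp only: symmetrization_add symmetrization_mul symmetrization_gen symmetrized_def
        free_prelie.mul_add_left free_prelie.mul_add_right add_ac)
    also have "\<dots> = 0" by (simp only: pl add_0)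
    finally show ?thesis .
  qed
  then have "symmetrization ?j = symmetrization 0" by (simp add: symmetrization_zero)
  moreover have "inj_on (symmetrization :: (nat, 'k) free_commag \<Rightarrow> (nat, 'k) free_prelie)
      (op_space ComMag {1..3})"
    using inj by (simp add: injective_morphism_def)
  ultimately have zero: "?j = 0"
    using j free_commag.mlin_zero by (auto simp: operad_simps dest!: inj_onD)
  interpret k: commag_algebra "(*) :: 'k \<Rightarrow> 'k \<Rightarrow> 'k" "(*)"
    by unfold_locales (simp_all add: algebra_simps)
  have "commag_ext (*) (*) (\<lambda>_. 1 :: 'k) ?j = 1 + 1 + 1"
    by (simp only: k.commag_ext_add k.commag_ext_mul k.commag_ext_gen mult_1)
  moreover have "commag_ext (*) (*) (\<lambda>_. 1 :: 'k) (0 :: (nat, 'k) free_commag) = 0"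
    using k.commag_ext_scale[of "\<lambda>_. 1" 0 0] by simp
  ultimately have "1 + 1 + 1 = (0 :: 'k)" by (simp only: zero)
  then show False by (simp only: one_add_one assms add_0 one_neq_zero)
qed

end

theory Submission
  imports Defs "HOL-Library.Poly_Mapping"
begin

text \<open>
  The morphism \<open>\<Phi>\<close> can only be the homomorphism \<open>symmetrization\<close>
  (\<open>operad_morphism_unique\<close>), so it suffices to find a pre-Lie algebra in which the symmetrized
  product of suitable elements is as free as a commutative product can be.  Such an algebra exists
  over every magma \<open>M\<close>: the words in \<open>M\<close> span a pre-Lie algebra in which
  \<open>[a] # [b] = [a b] + [b a]\<close> for all letters \<open>a, b \<in> M\<close>.

  The construction imitates integration by parts.  Read a word \<open>w\<^sub>0 \<dots> w\<^sub>k\<close> as a product of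
  noncommuting functions that vanish at the origin, and let
  \<open>p\<^sub>i = \<integral> w\<^sub>0 \<dots> (d w\<^sub>i) \<dots> w\<^sub>k\<close>.  The product rule gives
  \<open>p\<^sub>0 + \<dots> + p\<^sub>k = w\<^sub>0 \<dots> w\<^sub>k\<close>.  Now declare the product \<open>a b\<close> of the magma to be the
  signed area \<open>\<integral> ((d a) b - a (d b))\<close>; then \<open>p\<^sub>i - p\<^sub>i\<^sub>+\<^sub>1\<close> is an integral of the
  same shape over the shorter word in which \<open>w\<^sub>i, w\<^sub>i\<^sub>+\<^sub>1\<close> are replaced by their product.
  In characteristic zero these two rules determine the \<open>p\<^sub>i\<close> by recursion on the length, since the
  sum of \<open>k + 1\<close> unknowns and all their differences are known.  The resulting formal integrals
  inherit the rule \<open>d \<integral> = id\<close> (lemma \<open>sandwich_primitive\<close>), and this makes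
  \<open>x * y = \<integral> ((d x) y - y (d x))\<close> a pre-Lie product.  On letters,
  \<open>[a] # [b] = \<integral> ((d a) b - a (d b)) + \<integral> ((d b) a - b (d a)) = [a b] + [b a]\<close>.

  For \<open>M\<close> take the free \<open>ComMag\<close>-algebra itself, with half of its product.  The homomorphism from the
  free pre-Lie algebra to the words that sends each generator to its letter turns the symmetrized
  monomials into combinations of letters, and evaluating letters recovers the element of the free
  \<open>ComMag\<close>-algebra.  So \<open>symmetrization\<close> has a left inverse, on the multilinear part and beyond.
\<close>

section \<open>The vector space on a set of words\<close>

type_synonym ('m, 'k) wordspace = "'m list \<Rightarrow>\<^sub>0 'k"

abbreviation word :: "'m list \<Rightarrow> ('m, 'k::field) wordspace" where
  "word w \<equiv> Poly_Mapping.single w 1"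

definition wscale :: "'k::field \<Rightarrow> ('m, 'k) wordspace \<Rightarrow> ('m, 'k) wordspace" where
  "wscale c = Poly_Mapping.map ((*) c)"

lemma lookup_wscale: "Poly_Mapping.lookup (wscale c x) w = c * Poly_Mapping.lookup x w"
  by (simp add: wscale_def Poly_Mapping.map.rep_eq when_def)

interpretation words: vector_space "wscale :: 'k::field \<Rightarrow> ('m, 'k) wordspace \<Rightarrow> _"
  by unfold_locales
    (auto intro!: poly_mapping_eqI simp: lookup_wscale lookup_add algebra_simps)

lemma wordspace_induct [case_names zero add scale]:
  fixes x :: "('m, 'k::field) wordspace"
  assumes "P 0" and "\<And>x y. P x \<Longrightarrow> P y \<Longrightarrow> P (x + y)" and "\<And>c w. P (wscale c (word w))"
  shows "P x"
proof -
  have "x = (\<Sum>u\<in>Poly_Mapping.keys x. wscale (Poly_Mapping.lookup x u) (word u))"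
  proof (rule poly_mapping_eqI)
    fix w
    have "Poly_Mapping.lookup
        (\<Sum>u\<in>Poly_Mapping.keys x. wscale (Poly_Mapping.lookup x u) (word u)) w =
      (\<Sum>u\<in>Poly_Mapping.keys x. if u = w then Poly_Mapping.lookup x u else 0)"
      unfolding lookup_sum
      by (intro sum.cong) (auto simp: lookup_wscale lookup_single when_def)
    then show "Poly_Mapping.lookup x w =
        Poly_Mapping.lookup (\<Sum>u\<in>Poly_Mapping.keys x. wscale (Poly_Mapping.lookup x u) (word u)) w"
      by (auto simp: in_keys_iff)
  qed
  moreover have "P (\<Sum>u\<in>U. wscale (Poly_Mapping.lookup x u) (word u))" if "finite U" for U
    using that by induction (simp_all add: assms)
  ultimately show ?thesis by (metis finite_keys)
qed

definition extend ::
  "('k::field \<Rightarrow> 'b::ab_group_add \<Rightarrow> 'b) \<Rightarrow> ('m list \<Rightarrow> 'b) \<Rightarrow> ('m, 'k) wordspace \<Rightarrow> 'b" where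
  "extend scale f x = (\<Sum>w\<in>Poly_Mapping.keys x. scale (Poly_Mapping.lookup x w) (f w))"

context vector_space
begin

lemma extend_zero: "extend scale f 0 = 0"
  by (simp add: extend_def)

lemma extend_add: "extend scale f (x + y) = extend scale f x + extend scale f y"
  unfolding extend_def
  by (rule setsum_keys_plus_distrib) (simp_all add: scale_left_distrib)

lemma extend_scale:
  fixes c :: 'a
  shows "extend scale f (wscale c x) = scale c (extend scale f x)"
proof -
  have "extend scale f (wscale c x) =
    (\<Sum>w\<in>Poly_Mapping.keys x. scale (Poly_Mapping.lookup (wscale c x) w) (f w))"
    unfolding extend_def
    by (intro sum.mono_neutral_left) (auto simp: in_keys_iff lookup_wscale)
  then show ?thesis
    by (simp add: extend_def lookup_wscale scale_sum_right)
qed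

lemma extend_word: "extend scale f (word w) = f w"
  by (simp add: extend_def)

lemma extend_diff: "extend scale f (x - y) = extend scale f x - extend scale f y"
  using extend_add[of f "x - y" y] by simp

lemma extend_sum: "extend scale f (\<Sum>i\<in>I. g i) = (\<Sum>i\<in>I. extend scale f (g i))"
  by (induction I rule: infinite_finite_induct) (simp_all add: extend_zero extend_add)

lemma extend_add_fun: "extend scale (\<lambda>w. f w + g w) x = extend scale f x + extend scale g x"
  by (simp add: extend_def scale_right_distrib sum.distrib)

lemma extend_scale_fun:
  fixes c :: 'a
  shows "extend scale (\<lambda>w. scale c (f w)) x = scale c (extend scale f x)"
  by (simp add: extend_def scale_sum_right scale_scale mult.commute)

end

section \<open>Formal integrals of words\<close>

context
  fixes op :: "'m \<Rightarrow> 'm \<Rightarrow> 'm"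
begin

definition contract :: "nat \<Rightarrow> 'm list \<Rightarrow> 'm list" where
  "contract i w = take i w @ op (w ! i) (w ! Suc i) # drop (i + 2) w"

lemma length_contract: "Suc i < length w \<Longrightarrow> length (contract i w) = length w - 1"
  by (simp add: contract_def)

lemma contract_append_left:
  "contract (length u + i) (u @ w) = u @ contract i w"
  by (simp add: contract_def nth_append)

lemma contract_append_right:
  assumes "Suc i < length w"
  shows "contract i (w @ v) = contract i w @ v"
  using assms by (simp add: contract_def nth_append)

text \<open>
  The formal integral \<open>p\<^sub>j = \<integral> w\<^sub>0 \<dots> (d w\<^sub>j) \<dots> w\<^sub>k\<close>.  With \<open>n = k + 1\<close> and
  \<open>d\<^sub>i = p\<^sub>i - p\<^sub>i\<^sub>+\<^sub>1\<close>, which is already known from a shorter word, one has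
  \<open>p\<^sub>j = p\<^sub>0 - \<Sum>i<j. d\<^sub>i\<close>; summing over \<open>j\<close> shows that the product rule
  \<open>\<Sum>j. p\<^sub>j = w\<close> holds exactly if \<open>n p\<^sub>0 = w + \<Sum>i. (n - 1 - i) d\<^sub>i\<close>.  The bound
  \<open>min j (n - 1)\<close> only matters for positions \<open>j\<close> outside the word, where it keeps the recursion
  well-founded.
\<close>

function primitive :: "'m list \<Rightarrow> nat \<Rightarrow> ('m, 'k::field_char_0) wordspace" where
  "primitive w j =
    wscale (1 / of_nat (length w))
      (word w + (\<Sum>i<length w - 1. wscale (of_nat (length w - 1 - i)) (primitive (contract i w) i)))
    - (\<Sum>i<min j (length w - 1). primitive (contract i w) i)"
  by pat_completeness auto
termination
  by (relation "measure (\<lambda>(w, j). length w)") (auto simp: length_contract)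

declare primitive.simps [simp del]

lemma primitive_diff:
  assumes "Suc j < length w"
  shows "primitive w j - primitive w (Suc j) =
    (primitive (contract j w) j :: ('m, 'k::field_char_0) wordspace)"
proof -
  have "min j (length w - 1) = j" "min (Suc j) (length w - 1) = Suc j"
    using assms by auto
  then show ?thesis
    by (simp add: primitive.simps[of w])
qed

lemma sum_primitive:
  assumes "w \<noteq> []"
  shows "(\<Sum>j<length w. primitive w j) = (word w :: ('m, 'k::field_char_0) wordspace)"
proof -
  let ?n = "length w"
  let ?d = "\<lambda>i. primitive (contract i w) i :: ('m, 'k) wordspace"
  let ?t = "\<Sum>i<?n - 1. wscale (of_nat (?n - 1 - i)) (?d i)"
  have "(\<Sum>j<?n. \<Sum>i<min j (?n - 1). ?d i) = (\<Sum>j<?n. \<Sum>i | i \<in> {..<?n - 1} \<and> i < j. ?d i)"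
    by (intro sum.cong HOL.refl) auto
  also have "\<dots> = (\<Sum>i<?n - 1. \<Sum>j | j \<in> {..<?n} \<and> i < j. ?d i)"
    by (rule sum.swap_restrict) simp_all
  also have "\<dots> = ?t"
  proof (intro sum.cong HOL.refl)
    fix i assume "i \<in> {..<?n - 1}"
    have "(\<Sum>j | j \<in> {..<?n} \<and> i < j. ?d i) = (\<Sum>j<?n - 1 - i. ?d i)"
      by (rule sum.reindex_bij_witness[of _ "\<lambda>j. j + Suc i" "\<lambda>j. j - Suc i"]) auto
    then show "(\<Sum>j | j \<in> {..<?n} \<and> i < j. ?d i) = wscale (of_nat (?n - 1 - i)) (?d i)"
      by (simp add: words.sum_constant_scale)
  qed
  \<comment> \<open>\<open>d\<^sub>i\<close> is subtracted once for each of the \<open>n - 1 - i\<close> positions after \<open>i\<close>.\<close>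
  finally have inner: "(\<Sum>j<?n. \<Sum>i<min j (?n - 1). ?d i) = ?t" .
  have n: "(of_nat ?n :: 'k) \<noteq> 0" using assms by simp
  have "(\<Sum>j<?n. primitive w j) =
      (\<Sum>j<?n. wscale (1 / of_nat ?n) (word w + ?t)) - (\<Sum>j<?n. \<Sum>i<min j (?n - 1). ?d i)"
    by (simp only: primitive.simps[of w] sum_subtractf)
  also have "\<dots> = (word w + ?t) - ?t"
    unfolding inner using n by (simp add: words.sum_constant_scale)
  finally show ?thesis by simp
qed

lemma primitive_letter: "primitive [m] 0 = (word [m] :: ('m, 'k::field_char_0) wordspace)"
  using sum_primitive[of "[m]"] by simp

text \<open>The linear operator \<open>x \<mapsto> \<integral> u (d x) v\<close>, where \<open>d x\<close> is expanded by the product rule.\<close>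

definition sandwich ::
  "'m list \<Rightarrow> 'm list \<Rightarrow> ('m, 'k::field_char_0) wordspace \<Rightarrow> ('m, 'k) wordspace" where
  "sandwich u v = extend wscale (\<lambda>x. \<Sum>i<length x. primitive (u @ x @ v) (length u + i))"

lemma sandwich_add: "sandwich u v (x + y) = sandwich u v x + sandwich u v y"
  and sandwich_diff: "sandwich u v (x - y) = sandwich u v x - sandwich u v y"
  and sandwich_scale: "sandwich u v (wscale c x) = wscale c (sandwich u v x)"
  and sandwich_zero: "sandwich u v 0 = 0"
  and sandwich_sum: "sandwich u v (\<Sum>i\<in>I. g i) = (\<Sum>i\<in>I. sandwich u v (g i))"
  and sandwich_word:
    "sandwich u v (word w) =
      (\<Sum>i<length w. primitive (u @ w @ v) (length u + i) :: ('m, 'k::field_char_0) wordspace)"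
  by (simp_all add: sandwich_def words.extend_add words.extend_diff words.extend_scale
    words.extend_zero words.extend_sum words.extend_word)

text \<open>
  This is \<open>d \<integral> = id\<close>: differentiating the primitive \<open>p\<^sub>i\<close> of \<open>w\<close> between \<open>u\<close> and \<open>v\<close> gives back the
  form \<open>u w\<^sub>0 \<dots> (d w\<^sub>i) \<dots> w\<^sub>k v\<close>.  It holds because both sides have the same sum over
  \<open>i\<close> and, by induction on the length, the same consecutive differences; such a system has only one
  solution in characteristic zero.
\<close>

lemma sandwich_primitive:
  "i < length w \<Longrightarrow>
    sandwich u v (primitive w i) =
      (primitive (u @ w @ v) (length u + i) :: ('m, 'k::field_char_0) wordspace)"
proof (induction "length w" arbitrary: w i rule: less_induct)
  case less
  let ?e = "\<lambda>j. sandwich u v (primitive w j) - primitive (u @ w @ v) (length u + j) ::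
    ('m, 'k) wordspace"
  have step: "?e j = ?e (Suc j)" if j: "Suc j < length w" for j
  proof -
    have c: "contract (length u + j) (u @ w @ v) = u @ contract j w @ v"
      using j by (simp add: contract_append_left contract_append_right)
    have "sandwich u v (primitive w j) - sandwich u v (primitive w (Suc j)) =
        (sandwich u v (primitive (contract j w) j) :: ('m, 'k) wordspace)"
      by (simp only: sandwich_diff[symmetric] primitive_diff[OF j])
    also have "\<dots> = primitive (u @ contract j w @ v) (length u + j)"
      using j by (intro less.hyps) (auto simp: length_contract)
    also have "\<dots> = primitive (u @ w @ v) (length u + j) - primitive (u @ w @ v) (length u + Suc j)"
      using primitive_diff[of "length u + j" "u @ w @ v", where 'k='k] j by (simp add: c)
    finally show ?thesis by (simp add: algebra_simps)
  qed
  have const: "j < length w \<Longrightarrow> ?e j = ?e 0" for j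
    by (induction j) (auto simp: step)
  have w: "w \<noteq> []" using less.prems by auto
  have "(\<Sum>j<length w. ?e j) = 0"
    using sandwich_word[of u v w, where 'k='k]
    by (simp add: sum_subtractf sum_primitive[OF w] flip: sandwich_sum)
  moreover have "(\<Sum>j<length w. ?e j) = (\<Sum>j<length w. ?e 0)"
    by (intro sum.cong HOL.refl const) simp
  ultimately have "wscale (of_nat (length w)) (?e 0) = 0"
    by (simp add: words.sum_constant_scale)
  then have "?e 0 = 0" using w by simp
  then have "?e i = 0" using const[OF less.prems] by simp
  then show ?case by simp
qed

lemma sandwich_sandwich:
  "sandwich u' v' (sandwich u v x) =
    (sandwich (u' @ u) (v @ v') x :: ('m, 'k::field_char_0) wordspace)"
proof (induction x rule: wordspace_induct)
  case (scale c w)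
  have "sandwich u' v' (sandwich u v (word w)) =
      (\<Sum>i<length w. sandwich u' v' (primitive (u @ w @ v) (length u + i)) :: ('m, 'k) wordspace)"
    by (simp only: sandwich_word sandwich_sum)
  also have "\<dots> = sandwich (u' @ u) (v @ v') (word w)"
    unfolding sandwich_word
    by (intro sum.cong HOL.refl) (simp add: sandwich_primitive add_ac)
  finally show ?case by (simp add: sandwich_scale)
qed (simp_all add: sandwich_zero sandwich_add)

section \<open>The pre-Lie product on words\<close>

text \<open>
  \<open>x * y = \<integral> ((d x) y - y (d x))\<close>.  On nonempty words this is the pre-Lie product
  \<open>x \<prec> y - y \<succ> x\<close> of the dendriform algebra with
  \<open>x \<prec> y = \<integral> (d x) y\<close> and \<open>x \<succ> y = \<integral> x (d y)\<close>.
\<close>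

definition wmul ::
  "('m, 'k::field_char_0) wordspace \<Rightarrow> ('m, 'k) wordspace \<Rightarrow> ('m, 'k) wordspace" where
  "wmul x = extend wscale (\<lambda>v. sandwich [] v x - sandwich v [] x)"

lemma wmul_word: "wmul x (word v) = sandwich [] v x - sandwich v [] x"
  by (simp add: wmul_def words.extend_word)

lemma wmul_add_right: "wmul x (y + z) = wmul x y + wmul x z"
  and wmul_diff_right: "wmul x (y - z) = wmul x y - wmul x z"
  and wmul_scale_right: "wmul x (wscale c y) = wscale c (wmul x y)"
  and wmul_zero_right: "wmul x 0 = 0"
  by (simp_all add: wmul_def words.extend_add words.extend_diff words.extend_scale words.extend_zero)

lemma wmul_add_left: "wmul (x + y) z = wmul x z + wmul y z"
  by (simp add: wmul_def sandwich_add flip: words.extend_add_fun) (simp add: algebra_simps)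

lemma wmul_scale_left: "wmul (wscale c x) y = wscale c (wmul x y)"
  by (simp add: wmul_def sandwich_scale words.scale_right_diff_distrib
      flip: words.extend_scale_fun)

lemma wmul_zero_left: "wmul 0 y = 0"
  using wmul_add_left[of 0 0 y] by simp

text \<open>
  The product rule for a concatenation.  The empty word is a constant, so its derivative is zero and
  integration does not recover it.
\<close>

lemma sandwich_split:
  "sandwich [] v (word u) + sandwich u [] (word v) =
    (if u @ v = [] then 0 else word (u @ v) :: ('m, 'k::field_char_0) wordspace)"
proof -
  have "(\<Sum>i<m. f i) + (\<Sum>i<n. f (m + i)) = (\<Sum>i<m + n. f i)"
    for m n and f :: "nat \<Rightarrow> ('m, 'k) wordspace"
    by (induction n) (simp_all add: add_ac)
  then have "sandwich [] v (word u) + sandwich u [] (word v) =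
      (\<Sum>i<length (u @ v). primitive (u @ v) i :: ('m, 'k) wordspace)"
    by (simp add: sandwich_word)
  then show ?thesis
    using sum_primitive[of "u @ v", where 'k='k] by (cases "u @ v = []") auto
qed

text \<open>
  The Lie bracket of \<open>*\<close> is the commutator for concatenation: both products of a pair in the two
  orders combine to a total derivative.  The exceptional value at the empty word cancels.
\<close>

lemma wmul_commutator:
  "wmul (word u) (word v) - wmul (word v) (word u) =
    (word (u @ v) - word (v @ u) :: ('m, 'k::field_char_0) wordspace)"
proof -
  have "wmul (word u) (word v) - wmul (word v) (word u) =
      (sandwich [] v (word u) + sandwich u [] (word v)) -
      (sandwich [] u (word v) + sandwich v [] (word u) :: ('m, 'k) wordspace)"
    by (simp add: wmul_word)
  then show ?thesis by (simp add: sandwich_split)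
qed

text \<open>
  Right multiplication by a word is a difference of sandwich operators, and these compose by
  concatenation.  Hence the commutator of right multiplications by \<open>u\<close> and \<open>v\<close> is right
  multiplication by \<open>u v - v u\<close>, which is the bracket of \<open>u\<close> and \<open>v\<close>; this is the pre-Lie identity.
\<close>

lemma wmul_prelie:
  "wmul (wmul x y) z - wmul x (wmul y z) =
    (wmul (wmul x z) y - wmul x (wmul z y) :: ('m, 'k::field_char_0) wordspace)"
proof (induction y rule: wordspace_induct)
  case (scale c u)
  show ?case
  proof (induction z rule: wordspace_induct)
    case (scale d v)
    have "wmul (wmul x (word u)) (word v) - wmul (wmul x (word v)) (word u) =
        wmul x (word (u @ v) - word (v @ u))"
      by (simp add: wmul_word wmul_diff_right sandwich_diff sandwich_sandwich)
    also have "\<dots> = wmul x (wmul (word u) (word v)) - wmul x (wmul (word v) (word u))"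
      by (simp only: wmul_commutator[symmetric] wmul_diff_right)
    finally have "wmul (wmul x (word u)) (word v) - wmul x (wmul (word u) (word v)) =
        wmul (wmul x (word v)) (word u) - wmul x (wmul (word v) (word u))"
      by (simp add: algebra_simps)
    then have "wscale (c * d)
          (wmul (wmul x (word u)) (word v) - wmul x (wmul (word u) (word v))) =
        wscale (c * d)
          (wmul (wmul x (word v)) (word u) - wmul x (wmul (word v) (word u)))"
      by (rule arg_cong)
    then show ?case
      by (simp add: wmul_scale_left wmul_scale_right words.scale_right_diff_distrib
        mult.commute)
  qed (simp_all add: wmul_add_left wmul_add_right wmul_zero_right wmul_zero_left algebra_simps)
qed (simp_all add: wmul_add_left wmul_add_right wmul_zero_right wmul_zero_left algebra_simps)

lemma symmetrized_wmul_letters: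
  "symmetrized wmul (word [a]) (word [b]) =
    (word [op a b] + word [op b a] :: ('m, 'k::field_char_0) wordspace)"
proof -
  have d: "primitive [a, b] 0 - primitive [a, b] (Suc 0) =
      (word [op a b] :: ('m, 'k) wordspace)" for a b
    using primitive_diff[of 0 "[a, b]"] by (simp add: contract_def primitive_letter)
  have "symmetrized wmul (word [a]) (word [b]) =
      (primitive [a, b] 0 - primitive [a, b] (Suc 0)) +
      (primitive [b, a] 0 - primitive [b, a] (Suc 0) :: ('m, 'k) wordspace)"
    by (simp add: symmetrized_def wmul_word sandwich_word)
  then show ?thesis by (simp only: d)
qed

end

interpretation words: prelie_algebra
  "wscale :: 'k::field_char_0 \<Rightarrow> ('m, 'k) wordspace \<Rightarrow> _" "wmul op"
  by unfold_locales
    (simp_all add: wmul_add_left wmul_add_right wmul_scale_left wmul_scale_right wmul_prelie)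

section \<open>A left inverse of the symmetrization\<close>

text \<open>
  The factor \<open>1 / 2\<close> compensates for \<open>[a b] + [b a]\<close> being twice one letter when the magma is
  commutative.
\<close>

abbreviation half_mul ::
  "('x, 'k::field_char_0) free_commag \<Rightarrow> ('x, 'k) free_commag \<Rightarrow> ('x, 'k) free_commag" where
  "half_mul a b \<equiv> commag_scale (1 / 2) (commag_mul a b)"

definition to_words ::
  "('x, 'k::field_char_0) free_prelie \<Rightarrow> (('x, 'k) free_commag, 'k) wordspace" where
  "to_words = prelie_ext wscale (wmul half_mul) (\<lambda>x. word [commag_gen x])"

text \<open>
  Only words of length one are evaluated; the value \<open>0\<close> on all other words is an arbitrary linear
  extension.
\<close>

definition from_words ::
  "(('x, 'k::field_char_0) free_commag, 'k) wordspace \<Rightarrow> ('x, 'k) free_commag" where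
  "from_words = extend commag_scale (\<lambda>w. case w of [a] \<Rightarrow> a | _ \<Rightarrow> 0)"

definition letter_span :: "('m, 'k::field) wordspace set" where
  "letter_span = words.span (range (\<lambda>m. word [m]))"

lemma letter_mem_letter_span: "word [m] \<in> letter_span"
  by (simp add: letter_span_def words.span_base)

lemma letter_span_add: "x \<in> letter_span \<Longrightarrow> y \<in> letter_span \<Longrightarrow> x + y \<in> letter_span"
  and letter_span_scale: "x \<in> letter_span \<Longrightarrow> wscale c x \<in> letter_span"
  and letter_span_zero: "0 \<in> letter_span"
  by (simp_all add: letter_span_def words.span_add words.span_scale words.span_zero)

lemma letter_span_induct [consumes 1, case_names zero step]:
  assumes "x \<in> letter_span" and "P 0"
    and "\<And>c m x. x \<in> letter_span \<Longrightarrow> P x \<Longrightarrow> P (wscale c (word [m]) + x)"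
  shows "P x"
proof -
  have "x \<in> letter_span \<and> P x"
    using assms(1) unfolding letter_span_def
    by (induction rule: words.span_induct_alt)
      (auto simp: assms(2) words.span_zero intro!: words.span_add words.span_scale
        intro: words.span_base assms(3)[unfolded letter_span_def])
  then show ?thesis ..
qed

lemma from_words_add: "from_words (x + y) = from_words x + from_words y"
  and from_words_scale: "from_words (wscale c x) = commag_scale c (from_words x)"
  and from_words_zero: "from_words 0 = 0"
  and from_words_letter: "from_words (word [a]) = a"
  by (simp_all add: from_words_def free_commag.extend_add free_commag.extend_scale
    free_commag.extend_zero free_commag.extend_word)

text \<open>
  The product \<open>#\<close> on words turns into the free commutative product under evaluation, but only on
  combinations of letters.  That these are closed under \<open>#\<close> is therefore part of the statement.
\<close>

lemma symmetrized_wmul_letter_span: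
  fixes x y :: "(('x, 'k::field_char_0) free_commag, 'k) wordspace"
  assumes "x \<in> letter_span" and "y \<in> letter_span"
  shows "symmetrized (wmul half_mul) x y \<in> letter_span \<and>
    from_words (symmetrized (wmul half_mul) x y) = commag_mul (from_words x) (from_words y)"
proof -
  interpret S: commag_algebra "wscale :: 'k \<Rightarrow> (('x, 'k) free_commag, 'k) wordspace \<Rightarrow> _"
    "symmetrized (wmul half_mul)"
    by (rule words.commag_algebra_symmetrized)
  have S_zero: "symmetrized (wmul half_mul) 0 z = 0" "symmetrized (wmul half_mul) z 0 = 0"
    for z :: "(('x, 'k) free_commag, 'k) wordspace"
    using S.mul_scale_left[of 0 0 z] S.mul_scale_right[of z 0 0] by simp_all
  have letters: "symmetrized (wmul half_mul) (word [a]) (word [b]) \<in>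
        (letter_span :: (('x, 'k) free_commag, 'k) wordspace set) \<and>
      from_words (symmetrized (wmul half_mul) (word [a]) (word [b])) = commag_mul a b"
    for a b :: "('x, 'k) free_commag"
    by (simp add: symmetrized_wmul_letters letter_span_add letter_mem_letter_span from_words_add
        from_words_letter free_commag.mul_commute[of b a] flip: free_commag.scale_left_distrib)
  show ?thesis
    using assms(1)
  proof (induction rule: letter_span_induct)
    case zero
    then show ?case
      by (simp add: S_zero letter_span_zero from_words_zero free_commag.mul_zero_left)
  next
    case (step c a x)
    have "symmetrized (wmul half_mul) (word [a]) y \<in> letter_span \<and>
        from_words (symmetrized (wmul half_mul) (word [a]) y) = commag_mul a (from_words y)"
      using assms(2)
    proof (induction rule: letter_span_induct)
      case zero
      then show ?case
        by (simp add: S_zero letter_span_zero from_words_zero free_commag.mul_zero_right)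
    next
      case (step d b y)
      then show ?case
        using letters[of a b]
        by (simp add: S.mul_add_right S.mul_scale_right letter_span_add letter_span_scale
            from_words_add from_words_scale from_words_letter free_commag.mul_add_right
            free_commag.mul_scale_right)
    qed
    then show ?case
      using step
      by (simp add: S.mul_add_left S.mul_scale_left letter_span_add letter_span_scale
          from_words_add from_words_scale from_words_letter free_commag.mul_add_left
          free_commag.mul_scale_left)
  qed
qed

text \<open>
  On the image of \<open>symmetrization\<close> only letters occur, so \<open>from_words\<close> undoes \<open>to_words\<close> after
  \<open>symmetrization\<close>: the composite preserves all operations and fixes the generators.
\<close>

lemma to_words_symmetrization:
  fixes a :: "('x, 'k::field_char_0) free_commag"
  shows "to_words (symmetrization a) \<in> letter_span \<and> from_words (to_words (symmetrization a)) = a"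
proof -
  note ext = words.prelie_ext_gen words.prelie_ext_add words.prelie_ext_scale
    words.prelie_ext_mul
  have gen: "to_words (symmetrization (commag_gen x)) =
      (word [commag_gen x] :: (('x, 'k) free_commag, 'k) wordspace)" for x
    by (simp add: to_words_def symmetrization_gen ext)
  have add: "to_words (symmetrization (a + b)) =
      to_words (symmetrization a) + to_words (symmetrization b)"
    for a b :: "('x, 'k) free_commag"
    by (simp add: to_words_def symmetrization_add ext)
  have scale: "to_words (symmetrization (commag_scale c a)) =
      wscale c (to_words (symmetrization a))" for c and a :: "('x, 'k) free_commag"
    by (simp add: to_words_def symmetrization_scale ext)
  have mul: "to_words (symmetrization (commag_mul a b)) =
      symmetrized (wmul half_mul) (to_words (symmetrization a)) (to_words (symmetrization b))"
    for a b :: "('x, 'k) free_commag"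
    by (simp add: to_words_def symmetrization_mul symmetrized_def ext)
  have zero: "to_words (symmetrization 0) = (0 :: (('x, 'k) free_commag, 'k) wordspace)"
    using add[of 0 0] by simp
  have "to_words (symmetrization (abs_free_commag s)) \<in> letter_span \<and>
      from_words (to_words (symmetrization (abs_free_commag s))) = abs_free_commag s"
    for s :: "('x, 'k) alg_term"
  proof (induction s)
    case (TGen x)
    then show ?case
      by (simp add: gen letter_mem_letter_span from_words_letter flip: commag_gen.abs_eq)
  next
    case TZero
    then show ?case
      by (simp add: zero letter_span_zero from_words_zero flip: zero_free_commag_def)
  next
    case (TAdd s t)
    then show ?case
      by (simp add: add letter_span_add from_words_add flip: plus_free_commag.abs_eq)
  next
    case (TScale c s)
    then show ?case
      by (simp add: scale letter_span_scale from_words_scale flip: commag_scale.abs_eq)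
  next
    case (TMul s t)
    then show ?case
      by (simp add: mul symmetrized_wmul_letter_span flip: commag_mul.abs_eq)
  qed
  then show ?thesis
    by (induction a) blast
qed

lemma inj_symmetrization:
  "inj (symmetrization :: ('x, 'k::field_char_0) free_commag \<Rightarrow> ('x, 'k) free_prelie)"
  using to_words_symmetrization by (metis injI)

theorem theorem3p1:
  fixes \<Phi> :: "nat set \<Rightarrow> (nat, 'k::field_char_0) free_commag \<Rightarrow> (nat, 'k) free_prelie"
  assumes "operad_morphism ComMag preLie \<Phi>"
    and "\<Phi> {1..2} (commag_mul (commag_gen 1) (commag_gen 2)) =
      symmetrized prelie_mul (prelie_gen 1) (prelie_gen 2)"
  shows "injective_morphism ComMag \<Phi>"
  unfolding injective_morphism_def
proof (intro allI impI)
  fix n :: nat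
  assume "1 \<le> n"
  then have "label_set {1..n}" by (simp add: label_set_def)
  then have "\<Phi> {1..n} a = symmetrization a" if "a \<in> arity_space ComMag n" for a
    using operad_morphism_unique[OF assms] that by blast
  then show "inj_on (\<Phi> {1..n}) (arity_space ComMag n)"
    using inj_symmetrization by (metis inj_onI injD)
qed

end
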